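(* Let $f_1,\dots,f_n:I\to I$ be open functions, where $I$ is an open interval or $S^1$, and let $M$ be a minimal set for $IFS(f_1,\dots,f_n)$. Write $M=\mathcal{I}\cup K\cup N$ for its canonical decomposition (see context). Then $M$ is a symmetric Cantorval if and only if $M=\mathcal{I}\cup K$.
   Context: $IFS(f_1,\dots,f_n)$ is the set of all finite compositions (finite words) of the maps $f_1,\dots,f_n$. The orbit of $x$ is $O(x)=\{\phi(x):\phi\in IFS(f_1,\dots,f_n)\}$. A set $M$ is invariant if $f_i(M)\subset M$ for every $i=1,\dots,n$. A nonempty set $M$ is minimal for the IFS if it is closed, invariant, and $\overline{O(x)}=M$ for every $x\in M$. A function is open if it maps open sets to open sets. Canonical decomposition: every closed set $M\subset S^1$ can be written in a unique way as a disjoint union $M=\mathcal{I}\cup K\cup N$, where $\mathcal{I}$ is the union of the connected components of the interior of $M$, $K$ is the maximal Cantor set contained in $M\setminus\mathcal{I}$, and $N$ is a countable set; some of these parts may be empty. A symmetric Cantorval is a nonempty compact subset $M$ of $S^1$ (or of the real line) such that: (1) $M$ is the closure of its interior (i.e. the nontrivial connected components are dense); (2) both endpoints of any nontrivial connected component of $M$ are accumulation points of trivial (i.e. one-point) connected components of $M$.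
   Formalization: The right-hand side also requires the interior part of M to be nonempty (a minimal ternary Cantor set would otherwise be a counterexample), and when I is an open interval M is assumed compact (M = I = ℝ would otherwise be a counterexample). *)

theory Defs
  imports "HOL-Analysis.Analysis"
begin

text \<open>All notions are relative to an ambient space \<open>X\<close>; the intended instances are an open interval
  and the unit circle, each with its subspace topology.\<close>

inductive_set IFS :: "(nat \<Rightarrow> 'a \<Rightarrow> 'a) \<Rightarrow> nat \<Rightarrow> ('a \<Rightarrow> 'a) set"
  for f :: "nat \<Rightarrow> 'a \<Rightarrow> 'a" and n :: nat where
  generator: "i \<in> {1..n} \<Longrightarrow> f i \<in> IFS f n"
| composition: "i \<in> {1..n} \<Longrightarrow> \<phi> \<in> IFS f n \<Longrightarrow> f i \<circ> \<phi> \<in> IFS f n"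

text \<open>The empty word is left out. For \<open>n \<ge> 1\<close> this does not affect the notion of a minimal set:
  if \<open>{x} \<union> O(x)\<close> is dense in \<open>M\<close> for all \<open>x \<in> M\<close>, then \<open>closure O(x)\<close> contains the closure of
  \<open>{y} \<union> O(y)\<close> for \<open>y = f 1 x \<in> M\<close>, that is, all of \<open>M\<close>.\<close>

definition orbit :: "(nat \<Rightarrow> 'a \<Rightarrow> 'a) \<Rightarrow> nat \<Rightarrow> 'a \<Rightarrow> 'a set" where
  "orbit f n x = {\<phi> x |\<phi>. \<phi> \<in> IFS f n}"

definition invariant_set :: "(nat \<Rightarrow> 'a \<Rightarrow> 'a) \<Rightarrow> nat \<Rightarrow> 'a set \<Rightarrow> bool" where
  "invariant_set f n M \<longleftrightarrow> (\<forall>i\<in>{1..n}. f i ` M \<subseteq> M)"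

definition minimal_set :: "'a topology \<Rightarrow> (nat \<Rightarrow> 'a \<Rightarrow> 'a) \<Rightarrow> nat \<Rightarrow> 'a set \<Rightarrow> bool" where
  "minimal_set X f n M \<longleftrightarrow>
     M \<noteq> {} \<and> closedin X M \<and> invariant_set f n M \<and> (\<forall>x\<in>M. X closure_of orbit f n x = M)"

text \<open>A Cantor set is a nonempty, compact, perfect and totally disconnected set.\<close>

definition cantor_set :: "'a topology \<Rightarrow> 'a set \<Rightarrow> bool" where
  "cantor_set X K \<longleftrightarrow>
     K \<noteq> {} \<and> compactin X K \<and> X derived_set_of K = K \<and>
     (\<forall>C. connectedin X C \<and> C \<subseteq> K \<longrightarrow> (\<exists>x. C \<subseteq> {x}))"

text \<open>Maximality is with respect to inclusion; the Cantor part is empty exactly when there is no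
  Cantor set to choose from.\<close>

definition maximal_cantor_part :: "'a topology \<Rightarrow> 'a set \<Rightarrow> 'a set \<Rightarrow> bool" where
  "maximal_cantor_part X A K \<longleftrightarrow>
     (cantor_set X K \<and> K \<subseteq> A \<and> (\<forall>K'. cantor_set X K' \<and> K' \<subseteq> A \<and> K \<subseteq> K' \<longrightarrow> K' = K)) \<or>
     (K = {} \<and> \<not> (\<exists>K'. cantor_set X K' \<and> K' \<subseteq> A))"

definition canonical_decomposition ::
    "'a topology \<Rightarrow> 'a set \<Rightarrow> 'a set \<Rightarrow> 'a set \<Rightarrow> 'a set \<Rightarrow> bool" where
  "canonical_decomposition X M J K N \<longleftrightarrow>
     J = \<Union> (connected_components_of (subtopology X (X interior_of M))) \<and>
     maximal_cantor_part X (M - J) K \<and>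
     countable N \<and>
     M = J \<union> K \<union> N \<and> J \<inter> K = {} \<and> J \<inter> N = {} \<and> K \<inter> N = {}"

definition trivial_components :: "'a topology \<Rightarrow> 'a set \<Rightarrow> 'a set set" where
  "trivial_components X M = {C \<in> connected_components_of (subtopology X M). \<exists>x. C = {x}}"

definition nontrivial_components :: "'a topology \<Rightarrow> 'a set \<Rightarrow> 'a set set" where
  "nontrivial_components X M = connected_components_of (subtopology X M) - trivial_components X M"

text \<open>In an interval or the circle, a nontrivial component of a compact set is a compact arc, whose
  endpoints are its two frontier points, or else the entire circle, which has no endpoints.\<close>

definition symmetric_cantorval :: "'a topology \<Rightarrow> 'a set \<Rightarrow> bool" where
  "symmetric_cantorval X M \<longleftrightarrow>
     M \<noteq> {} \<and> compactin X M \<and>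
     M = X closure_of (X interior_of M) \<and>
     (\<forall>C \<in> nontrivial_components X M. \<forall>p \<in> X frontier_of C.
        p \<in> X derived_set_of \<Union> (trivial_components X M))"

end

theory Submission
  imports Defs
begin

text \<open>Let \<open>J\<close> be the interior of \<open>M\<close> and \<open>T\<close> the union of the one-point components. Points of \<open>J\<close>
  lie in nontrivial components, so \<open>T\<close> is contained in the boundary \<open>M - J\<close>. This boundary is
  closed and contains no arc, since an arc has interior points in the one-dimensional ambient
  space. Hence \<open>M - J\<close> is a Cantor set as soon as it is nonempty and perfect.

  The dynamics enters only once (\<open>minimal_set_eq_closure_interior\<close>): open maps that preserve
  \<open>M\<close> also preserve \<open>J\<close>, so the orbit of a point of \<open>J\<close> stays in \<open>J\<close>; as it is dense in \<open>M\<close>,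
  the set \<open>M\<close> is the closure of \<open>J\<close> whenever \<open>J\<close> is nonempty. The rest is topology of compact
  sets in one dimension.

  Suppose \<open>M\<close> is a symmetric Cantorval and \<open>p\<close> is an isolated point of \<open>M - J\<close>. Near \<open>p\<close>, each of the
  two sides of \<open>p\<close> is free of boundary points, so it lies inside \<open>J\<close> or misses \<open>J\<close>. At least one side
  lies in \<open>J\<close>, because \<open>p\<close> is in the closure of \<open>J\<close>. So \<open>p\<close> is an endpoint of a nontrivial component,
  hence a limit of points of \<open>T\<close>, hence of \<open>M - J\<close>, which contradicts isolation. Therefore \<open>M - J\<close>
  is perfect (\<open>cantorval_boundary_perfect\<close>), and the maximal Cantor part \<open>K\<close> is all of \<open>M - J\<close>.

  Conversely, suppose \<open>J\<close> is nonempty and \<open>K = M - J\<close>, and let \<open>p\<close> be an endpoint of a nontrivial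
  component. Then \<open>p \<in> K\<close>. By Baire's theorem a nonempty relatively open part of the perfect
  compact set \<open>K\<close> is uncountable (\<open>perfect_compact_not_locally_countable\<close>). But a point of \<open>K - T\<close> is
  a boundary point of \<open>M\<close> at which an arc of \<open>M\<close> ends, and there are only countably many of these
  (\<open>countable_nontrivial_boundary\<close>). So \<open>T\<close> accumulates at \<open>p\<close>.

  The interval and the circle are treated together: both are images of an open set of reals under
  a continuous open map with discrete fibres, namely the identity and \<open>t \<mapsto> cis t\<close>.\<close>

section \<open>Countability and category\<close>

text \<open>If \<open>{t..s} \<subseteq> A\<close> and \<open>t\<close> is not interior to \<open>A\<close>, then \<open>t\<close> is the left end of such an arc, and no
  other left end lies in \<open>{t<..<s}\<close>, whose points are interior to \<open>A\<close>. Choosing a rational number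
  in each of these disjoint intervals counts the left ends.\<close>

lemma countable_left_ends:
  fixes A :: "real set"
  shows "countable {t. t \<notin> interior A \<and> (\<exists>s>t. {t..s} \<subseteq> A)}" (is "countable ?L")
proof -
  have "\<forall>t\<in>?L. \<exists>s. t < s \<and> {t..s} \<subseteq> A"
    by blast
  then obtain s where s: "\<forall>t\<in>?L. t < s t \<and> {t..s t} \<subseteq> A"
    by (rule bchoice[THEN exE])
  then have "\<forall>t\<in>?L. \<exists>r. r \<in> \<rat> \<and> t < r \<and> r < s t"
    using Rats_dense_in_real by blast
  then obtain r where r: "\<forall>t\<in>?L. r t \<in> \<rat> \<and> t < r t \<and> r t < s t"
    by (rule bchoice[THEN exE])
  have apart: "s t \<le> u" if "t \<in> ?L" "u \<in> ?L" "t < u" for t u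
  proof (rule ccontr)
    assume "\<not> s t \<le> u"
    moreover have "{t<..<s t} \<subseteq> interior A"
      using bspec[OF s \<open>t \<in> ?L\<close>] by (intro interior_maximal) auto
    moreover from calculation \<open>t < u\<close> have "u \<in> {t<..<s t}"
      by simp
    ultimately show False
      using \<open>u \<in> ?L\<close> by blast
  qed
  have inj: "inj_on r ?L"
  proof (rule linorder_inj_onI')
    fix t u assume "t \<in> ?L" "u \<in> ?L" "t < u"
    then show "r t \<noteq> r u"
      using apart[of t u] bspec[OF r, of t] bspec[OF r, of u] by linarith
  qed
  have "r ` ?L \<subseteq> \<rat>"
    using r by blast
  then have "countable (r ` ?L)"
    using countable_rat by (rule countable_subset)
  then show ?thesis
    using inj by (rule countable_image_inj_on)
qed

text \<open>A segment at \<open>t\<close> extends to the right or to the left; reflection turns right ends into left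
  ends.\<close>

lemma countable_segment_ends:
  fixes A :: "real set"
  shows "countable {t. t \<notin> interior A \<and> (\<exists>s. s \<noteq> t \<and> closed_segment t s \<subseteq> A)}" (is "countable ?E")
proof -
  let ?L = "\<lambda>A. {t::real. t \<notin> interior A \<and> (\<exists>s>t. {t..s} \<subseteq> A)}"
  have "t \<in> ?L A \<union> uminus ` ?L (uminus ` A)" if t: "t \<in> ?E" for t
  proof -
    obtain s where s: "s \<noteq> t" "closed_segment t s \<subseteq> A"
      using t by blast
    show ?thesis
    proof (cases "t < s")
      case True
      then show ?thesis
        using s t by (auto simp: closed_segment_eq_real_ivl)
    next
      case False
      then have "{s..t} \<subseteq> A"
        using s by (auto simp: closed_segment_eq_real_ivl split: if_splits)
      then have "{-t..-s} \<subseteq> uminus ` A"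
        by (metis image_mono image_uminus_atLeastAtMost)
      moreover have "- t \<notin> interior (uminus ` A)"
        using t by (auto simp: interior_negations)
      ultimately have "- t \<in> ?L (uminus ` A)"
        using s(1) False by (intro CollectI conjI exI[of _ "- s"]) auto
      then have "- (- t) \<in> uminus ` ?L (uminus ` A)"
        by (rule imageI)
      then show ?thesis
        by simp
    qed
  qed
  then have "?E \<subseteq> ?L A \<union> uminus ` ?L (uminus ` A)"
    by blast
  then show ?thesis
    by (rule countable_subset) (intro countable_Un countable_image countable_left_ends)
qed

text \<open>In a compact perfect Hausdorff space, points are closed with empty interior, so by Baire's
  theorem a countable set has empty interior.\<close>

lemma perfect_compact_not_locally_countable:
  assumes "Hausdorff_space X" "compactin X K" "X derived_set_of K = K"
    and "openin X U" "U \<inter> K \<noteq> {}" "countable E"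
  obtains y where "y \<in> U \<inter> K" "y \<notin> E"
proof -
  let ?Y = "subtopology X K"
  have KX: "K \<subseteq> topspace X"
    using assms(2) compactin_subset_topspace by blast
  have H: "Hausdorff_space ?Y" and "compact_space ?Y"
    using assms by (auto simp: Hausdorff_space_subtopology compactin_subspace)
  then have lc: "locally_compact_space ?Y" "regular_space ?Y"
    by (auto intro: compact_imp_locally_compact_space compact_Hausdorff_imp_regular_space)
  have int: "?Y interior_of {x} = {}" for x
  proof (rule ccontr)
    assume "?Y interior_of {x} \<noteq> {}"
    then have "?Y interior_of {x} = {x}"
      using interior_of_subset[of ?Y "{x}"] by blast
    then obtain V where "openin X V" "{x} = V \<inter> K"
      by (metis openin_interior_of openin_subtopology)
    moreover from this have "x \<in> X derived_set_of K"
      using assms(3) by blast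
    ultimately show False
      unfolding in_derived_set_of by blast
  qed
  have "?Y interior_of \<Union> ((\<lambda>x. {x}) ` (E \<inter> K)) = {}"
  proof (rule Baire_category_alt)
    show "countable ((\<lambda>x. {x}) ` (E \<inter> K))"
      using assms(6) by (simp add: countable_Int1)
    fix T assume "T \<in> (\<lambda>x. {x}) ` (E \<inter> K)"
    then show "closedin ?Y T \<and> ?Y interior_of T = {}"
      using int H KX by (auto intro!: closedin_Hausdorff_singleton)
  qed (use lc in auto)
  moreover have "openin ?Y (U \<inter> K)"
    using assms(4) openin_subtopology by blast
  ultimately have "\<not> U \<inter> K \<subseteq> E"
    using assms(5) interior_of_maximal[of "U \<inter> K" "\<Union> ((\<lambda>x. {x}) ` (E \<inter> K))" ?Y] by blast
  then show ?thesis
    using that by blast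
qed

section \<open>Minimal sets of open maps\<close>

text \<open>The image of the interior is open and contained in \<open>M\<close>, hence contained in the interior. So
  the interior traps the orbits of its points, and these are dense in \<open>M\<close>.\<close>

lemma minimal_set_eq_closure_interior:
  assumes "\<And>i. i \<in> {1..n} \<Longrightarrow> open_map X X (f i)"
    and "minimal_set X f n M" "X interior_of M \<noteq> {}"
  shows "X closure_of (X interior_of M) = M"
proof
  have M: "closedin X M" "invariant_set f n M" "\<And>x. x \<in> M \<Longrightarrow> X closure_of orbit f n x = M"
    using assms(2) by (auto simp: minimal_set_def)
  show "X closure_of (X interior_of M) \<subseteq> M"
    using M(1) by (simp add: closure_of_minimal interior_of_subset)
  have inv: "f i ` (X interior_of M) \<subseteq> X interior_of M" if "i \<in> {1..n}" for i
  proof (rule interior_of_maximal)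
    show "f i ` (X interior_of M) \<subseteq> M"
      using M(2) that interior_of_subset[of X M] by (fastforce simp: invariant_set_def)
    show "openin X (f i ` (X interior_of M))"
      using assms(1)[OF that] by (simp add: open_map_def)
  qed
  obtain x where x: "x \<in> X interior_of M"
    using assms(3) by blast
  have "\<phi> x \<in> X interior_of M" if "\<phi> \<in> IFS f n" for \<phi>
    using that by induction (use inv x in auto)
  then have "orbit f n x \<subseteq> X interior_of M"
    by (auto simp: orbit_def)
  then show "M \<subseteq> X closure_of (X interior_of M)"
    using M(3) x closure_of_mono interior_of_subset by (metis subsetD)
qed

section \<open>Spaces parametrized by an open set of reals\<close>

text \<open>What the interval and the circle have in common as one-dimensional spaces. Discreteness of
  the fibres guarantees that a nondegenerate segment of parameters never collapses to a point;
  global injectivity would exclude the circle.\<close>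

locale arc_parametrization =
  fixes S :: "'a::metric_space set" and D :: "real set" and h :: "real \<Rightarrow> 'a"
  assumes open_domain: "open D"
    and cont: "continuous_on D h"
    and onto: "h ` D = S"
    and open_image: "\<And>W. open W \<Longrightarrow> W \<subseteq> D \<Longrightarrow> openin (top_of_set S) (h ` W)"
    and discrete_fibres: "\<And>t. t \<in> D \<Longrightarrow> eventually (\<lambda>s. h s \<noteq> h t) (at t)"
begin

abbreviation X :: "'a topology" where "X \<equiv> top_of_set S"

lemma small_interval:
  assumes "t \<in> D" "openin X U" "h t \<in> U"
  obtains e where "e > 0" "{t-e..t+e} \<subseteq> D" "h ` {t-e..t+e} \<subseteq> U"
    "\<And>s. s \<in> {t-e..t+e} \<Longrightarrow> s \<noteq> t \<Longrightarrow> h s \<noteq> h t"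
proof -
  obtain V where V: "open V" "U = S \<inter> V"
    using assms(2) openin_open by metis
  have "open (D \<inter> h -` V)"
    using cont open_domain V(1) by (rule continuous_open_preimage)
  then obtain d where d: "d > 0" "ball t d \<subseteq> D \<inter> h -` V"
    using assms V open_contains_ball by (metis IntD2 IntI vimageI)
  obtain d' where d': "d' > 0" "\<And>s. s \<noteq> t \<Longrightarrow> dist s t < d' \<Longrightarrow> h s \<noteq> h t"
    using discrete_fibres[OF assms(1)] by (auto simp: eventually_at)
  define e where "e = min d d' / 2"
  have e: "e > 0" "e < d" "e < d'"
    using d d' by (auto simp: e_def min_def)
  have sub: "{t-e..t+e} \<subseteq> ball t d"
    using e by (auto simp: dist_real_def)
  show ?thesis
  proof
    show "h ` {t-e..t+e} \<subseteq> U" "{t-e..t+e} \<subseteq> D"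
      using sub d(2) V(2) onto by auto
    show "h s \<noteq> h t" if "s \<in> {t-e..t+e}" "s \<noteq> t" for s
    proof (rule d'(2)[OF that(2)])
      show "dist s t < d'"
        using that(1) e unfolding dist_real_def atLeastAtMost_iff by linarith
    qed
  qed (use e in auto)
qed

lemma connectedin_image:
  assumes "connected T" "T \<subseteq> D"
  shows "connectedin X (h ` T)"
proof -
  have "connected (h ` T)"
    using assms cont by (meson connected_continuous_image continuous_on_subset)
  then show ?thesis
    using assms onto by (auto simp: connectedin_subtopology)
qed

lemma image_subset_component:
  assumes "C \<in> connected_components_of (subtopology X M)"
    and "connected T" "T \<subseteq> D" "h ` T \<subseteq> M" "u \<in> T" "h u \<in> C"
  shows "h ` T \<subseteq> C"
proof (rule connected_components_of_maximal[OF assms(1)])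
  show "connectedin (subtopology X M) (h ` T)"
    unfolding connectedin_subtopology[of X M] using connectedin_image[OF assms(2,3)] assms(4) by simp
  show "\<not> disjnt C (h ` T)"
    using assms(5,6) unfolding disjnt_def by blast
qed

text \<open>If \<open>C\<close> contained no arc at \<open>h t\<close> on either side, there would be parameters \<open>a < t < b\<close> close to \<open>t\<close>
  with \<open>h a\<close> and \<open>h b\<close> outside \<open>C\<close>. The small arc between them then cuts out of \<open>C\<close> a piece that is
  both open and closed, contains \<open>h t\<close> and misses \<open>y\<close>.\<close>

lemma connected_set_contains_arc:
  assumes "connectedin X C" "t \<in> D" "h t \<in> C" "y \<in> C" "y \<noteq> h t"
  obtains s where "s \<noteq> t" "closed_segment t s \<subseteq> D" "h ` closed_segment t s \<subseteq> C"
proof (rule ccontr)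
  assume "\<not> thesis"
  with that have none: "\<And>s. s \<noteq> t \<Longrightarrow> closed_segment t s \<subseteq> D \<Longrightarrow> \<not> h ` closed_segment t s \<subseteq> C"
    by blast
  have C: "connected C" "C \<subseteq> S"
    using assms(1) by (auto simp: connectedin_subtopology)
  have "openin X (S - {y})"
    by (simp add: openin_delete)
  then obtain e where e: "e > 0" "{t-e..t+e} \<subseteq> D" "h ` {t-e..t+e} \<subseteq> S - {y}"
    using small_interval[OF assms(2), of "S - {y}"] assms C by (metis Diff_iff singletonD subsetD)
  have "\<not> h ` {t-e..t} \<subseteq> C"
  proof -
    have seg: "closed_segment t (t - e) = {t-e..t}" and sub: "{t-e..t} \<subseteq> {t-e..t+e}"
      using e(1) by (simp_all add: closed_segment_eq_real_ivl)
    then show ?thesis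
      using none[of "t - e"] e(1) subset_trans[OF sub e(2)] by simp
  qed
  then obtain a where a: "a \<in> {t-e..t}" "h a \<notin> C"
    by blast
  have "\<not> h ` {t..t+e} \<subseteq> C"
  proof -
    have seg: "closed_segment t (t + e) = {t..t+e}" and sub: "{t..t+e} \<subseteq> {t-e..t+e}"
      using e(1) by (simp_all add: closed_segment_eq_real_ivl)
    then show ?thesis
      using none[of "t + e"] e(1) subset_trans[OF sub e(2)] by simp
  qed
  then obtain b where b: "b \<in> {t..t+e}" "h b \<notin> C"
    by blast
  have ab: "a < t" "t < b"
    using a b assms(3) by (auto simp: order.order_iff_strict)
  have D: "{a..b} \<subseteq> D" "{a<..<b} \<subseteq> D"
    using a b e(2) by (auto simp: subset_iff)
  \<comment> \<open>The ends of the arc are outside \<open>C\<close>, so the open and the closed arc meet \<open>C\<close> in the same set.\<close>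
  have eq: "C \<inter> h ` {a..b} = C \<inter> h ` {a<..<b}"
  proof -
    have "{a..b} = insert a (insert b {a<..<b})"
      using ab by auto
    then show ?thesis
      using a b by auto
  qed
  have "openin (top_of_set C) (C \<inter> h ` {a<..<b})"
    using openin_subtopology_Int2[OF open_image[OF open_greaterThanLessThan D(2)], of C]
    unfolding subtopology_subtopology Int_absorb1[OF C(2)] .
  moreover have "compact (h ` {a..b})"
    using D cont by (meson compact_Icc compact_continuous_image continuous_on_subset)
  then have "closedin (top_of_set C) (C \<inter> h ` {a<..<b})"
    unfolding eq[symmetric] by (intro closedin_closed_Int compact_imp_closed)
  moreover have "C \<inter> h ` {a<..<b} \<noteq> {}"
    using ab assms(3) by auto
  ultimately have "C \<inter> h ` {a<..<b} = C"
    using C(1) connected_clopen by blast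
  moreover have "y \<notin> h ` {a<..<b}"
    using e(3) a b by fastforce
  ultimately show False
    using assms(4) by blast
qed

section \<open>Components and the boundary of a set\<close>

text \<open>An interior point has a whole arc of \<open>M\<close> around it, which discreteness of the fibres keeps from
  being a single point, so its component is nontrivial.\<close>

lemma trivial_components_disjoint_interior:
  "\<Union> (trivial_components X M) \<subseteq> M - X interior_of M"
proof
  fix x assume "x \<in> \<Union> (trivial_components X M)"
  then have x: "{x} \<in> connected_components_of (subtopology X M)"
    by (auto simp: trivial_components_def)
  then have "x \<in> S \<inter> M"
    using connected_components_of_subset by fastforce
  then obtain t where t: "t \<in> D" "x = h t" "x \<in> M"
    using onto by blast
  have False if xJ: "x \<in> X interior_of M"
  proof -
    obtain e where e: "e > 0" "{t-e..t+e} \<subseteq> D" "h ` {t-e..t+e} \<subseteq> X interior_of M"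
      "\<And>s. s \<in> {t-e..t+e} \<Longrightarrow> s \<noteq> t \<Longrightarrow> h s \<noteq> h t"
      using small_interval[OF t(1) openin_interior_of xJ[unfolded t(2)]] by metis
    have "h ` {t-e..t+e} \<subseteq> {x}"
    proof (rule image_subset_component[OF x])
      show "h ` {t-e..t+e} \<subseteq> M"
        using e(3) interior_of_subset by (rule subset_trans)
    qed (use e t in auto)
    then have "h (t + e) = x"
      using e(1) by (simp add: image_subset_iff)
    then show False
      using e(1) e(4)[of "t + e"] t(2) by simp
  qed
  then show "x \<in> M - X interior_of M"
    using t by blast
qed

lemma arc_in_nontrivial_component:
  assumes "M \<subseteq> S" "t \<in> D" "h t \<in> M" "h t \<notin> \<Union> (trivial_components X M)"
  obtains s where "s \<noteq> t" "closed_segment t s \<subseteq> D" "h ` closed_segment t s \<subseteq> M"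
proof -
  have "h t \<in> topspace (subtopology X M)"
    using assms by auto
  then obtain C where C: "C \<in> connected_components_of (subtopology X M)" "h t \<in> C"
    using Union_connected_components_of by (metis UnionE)
  then have "C \<noteq> {h t}"
    using assms(4) by (auto simp: trivial_components_def)
  then obtain y where y: "y \<in> C" "y \<noteq> h t"
    using C by blast
  have "connectedin X C" "C \<subseteq> M"
    using connectedin_connected_components_of[OF C(1)] unfolding connectedin_subtopology[of X M]
    by simp_all
  moreover from this obtain s where "s \<noteq> t" "closed_segment t s \<subseteq> D" "h ` closed_segment t s \<subseteq> C"
    using connected_set_contains_arc[OF _ assms(2) C(2) y] by blast
  ultimately show ?thesis
    using that by (meson subset_trans)
qed

text \<open>A boundary point in a nontrivial component is an endpoint of an arc in \<open>M\<close>. Pulled back to the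
  parameter domain it becomes an end of a segment that is not interior to the preimage of \<open>M\<close>,
  because \<open>h\<close> is open.\<close>

lemma countable_nontrivial_boundary:
  assumes "M \<subseteq> S"
  shows "countable (M - X interior_of M - \<Union> (trivial_components X M))" (is "countable ?E")
proof -
  let ?A = "{t \<in> D. h t \<in> M}"
  have "?E \<subseteq> h ` {t. t \<notin> interior ?A \<and> (\<exists>s. s \<noteq> t \<and> closed_segment t s \<subseteq> ?A)}"
  proof
    fix x assume x: "x \<in> ?E"
    then obtain t where t: "t \<in> D" "x = h t"
      using assms onto by blast
    then obtain s where s: "s \<noteq> t" "closed_segment t s \<subseteq> D" "h ` closed_segment t s \<subseteq> M"
      using arc_in_nontrivial_component[OF assms, of t] x by blast
    have "openin X (h ` interior ?A)"
      using interior_subset by (intro open_image) auto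
    moreover have "h ` interior ?A \<subseteq> M"
      using interior_subset by fastforce
    ultimately have "h ` interior ?A \<subseteq> X interior_of M"
      by (rule interior_of_maximal[rotated])
    then have "t \<notin> interior ?A"
      using x t by blast
    moreover have "closed_segment t s \<subseteq> ?A"
      using s by blast
    ultimately show "x \<in> h ` {t. t \<notin> interior ?A \<and> (\<exists>s. s \<noteq> t \<and> closed_segment t s \<subseteq> ?A)}"
      using t s(1) by blast
  qed
  then show ?thesis
    by (rule countable_subset[OF _ countable_image[OF countable_segment_ends]])
qed

text \<open>A connected set with two points contains an arc, and the arc without its endpoints is the image
  of an open segment; being open, it would lie in the interior of \<open>M\<close>.\<close>

lemma no_arc_in_boundary:
  assumes "connectedin X C" "C \<subseteq> M - X interior_of M"
  shows "\<exists>x. C \<subseteq> {x}"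
proof (rule ccontr)
  assume *: "\<nexists>x. C \<subseteq> {x}"
  then obtain x y where xy: "x \<in> C" "y \<in> C" "y \<noteq> x"
    by blast
  have "x \<in> S"
    using assms(1) xy by (auto simp: connectedin_subtopology)
  then obtain t where t: "t \<in> D" "x = h t"
    using onto by blast
  then obtain s where s: "s \<noteq> t" "closed_segment t s \<subseteq> D" "h ` closed_segment t s \<subseteq> C"
    using connected_set_contains_arc[OF assms(1)] xy by metis
  have seg: "open_segment t s \<subseteq> closed_segment t s"
    by (simp add: open_segment_def)
  have "openin X (h ` open_segment t s)"
    using seg s by (intro open_image) (auto simp: open_segment_eq_real_ivl)
  then have "h ` open_segment t s \<subseteq> X interior_of M"
    using seg s assms(2) by (intro interior_of_maximal) auto
  moreover have "open_segment t s \<noteq> {}"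
    using s(1) open_segment_eq_empty by metis
  ultimately show False
    using seg s assms(2) by blast
qed

text \<open>An isolated boundary point \<open>p\<close> would have an arc of interior points on at least one side. This
  makes it an endpoint of a nontrivial component, so that trivial components, all of which lie in
  the boundary, accumulate at it.\<close>

lemma cantorval_boundary_perfect:
  assumes "symmetric_cantorval X M"
  shows "X derived_set_of (M - X interior_of M) = M - X interior_of M"
proof
  let ?J = "X interior_of M" and ?T = "\<Union> (trivial_components X M)"
  have M: "compactin X M" "M = X closure_of ?J"
    and ends: "\<And>C p. C \<in> nontrivial_components X M \<Longrightarrow> p \<in> X frontier_of C \<Longrightarrow> p \<in> X derived_set_of ?T"
    using assms unfolding symmetric_cantorval_def by blast+
  have MS: "M \<subseteq> S"
    using M(1) by (auto simp: compactin_subtopology)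
  have "closedin X M"
    using M(2) closedin_closure_of by metis
  then have "closedin X (M - ?J)"
    by (simp add: closedin_diff)
  then show "X derived_set_of (M - ?J) \<subseteq> M - ?J"
    by (simp add: closedin_contains_derived_set)
  show "M - ?J \<subseteq> X derived_set_of (M - ?J)"
  proof
    fix p assume p: "p \<in> M - ?J"
    show "p \<in> X derived_set_of (M - ?J)"
    proof (rule ccontr)
      assume isolated: "p \<notin> X derived_set_of (M - ?J)"
      obtain t where t: "t \<in> D" "p = h t"
        using p MS onto by blast
      obtain U where U: "openin X U" "p \<in> U" "\<And>y. y \<in> M - ?J \<Longrightarrow> y \<in> U \<Longrightarrow> y = p"
        using isolated p MS unfolding in_derived_set_of by auto
      obtain e where e: "e > 0" "{t-e..t+e} \<subseteq> D" "h ` {t-e..t+e} \<subseteq> U"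
        "\<And>s. s \<in> {t-e..t+e} \<Longrightarrow> s \<noteq> t \<Longrightarrow> h s \<noteq> h t"
        using small_interval[OF t(1) U(1) U(2)[unfolded t(2)]] by metis
      \<comment> \<open>Close to \<open>t\<close>, a connected set of parameters that avoids \<open>t\<close> meets no boundary point; hence
          its image lies in the interior as soon as one of its points does.\<close>
      have side: "h ` T \<subseteq> ?J" if T: "connected T" "T \<subseteq> {t-e..t+e} - {t}" and u: "u \<in> T" "h u \<in> ?J" for T u
      proof -
        have con: "connectedin X (h ` T)"
          using T e by (intro connectedin_image) auto
        have "h ` T \<inter> (M - ?J) = {}"
        proof -
          have "h s \<notin> M - ?J" if "s \<in> T" for s
            using that T(2) e(3) e(4)[of s] U(3)[of "h s"] t(2) by blast
          then show ?thesis
            by blast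
        qed
        moreover have "X frontier_of ?J \<subseteq> M - ?J"
          using M(2) by (simp add: frontier_of_def)
        ultimately have "h ` T \<inter> X frontier_of ?J = {}"
          by blast
        moreover have "h ` T \<inter> ?J \<noteq> {}"
          using u by blast
        ultimately show ?thesis
          using connectedin_Int_frontier_of[OF con, of ?J] by blast
      qed
      have near: "openin X (h ` {t-e<..<t+e})"
        using e(2) by (intro open_image) auto
      have "p \<in> h ` {t-e<..<t+e}"
        using t e(1) by auto
      moreover have "p \<in> X closure_of ?J"
        using p M(2) by blast
      ultimately obtain q where "q \<in> ?J" "q \<in> h ` {t-e<..<t+e}"
        using near unfolding in_closure_of by blast
      then obtain s where s: "s \<in> {t-e<..<t+e}" "h s \<in> ?J"
        by blast
      \<comment> \<open>The parameter \<open>s\<close> of an interior point near \<open>p\<close> tells which side of \<open>t\<close> to take.\<close>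
      have arc: "\<exists>T. connected (insert t T) \<and> T \<subseteq> {t-e..t+e} - {t} \<and> T \<noteq> {} \<and> h ` T \<subseteq> ?J"
      proof (cases "s < t")
        case True
        have "insert t {t-e<..<t} = {t-e<..t}"
          using e(1) by auto
        moreover have "h ` {t-e<..<t} \<subseteq> ?J"
          using s True by (intro side[of _ s]) auto
        ultimately show ?thesis
          using e(1) by (intro exI[of _ "{t-e<..<t}"]) auto
      next
        case False
        then have "t < s"
          using s p t by (metis DiffD2 linorder_neqE)
        moreover have "insert t {t<..<t+e} = {t..<t+e}"
          using e(1) by auto
        moreover have "h ` {t<..<t+e} \<subseteq> ?J"
          using s \<open>t < s\<close> by (intro side[of _ s]) auto
        ultimately show ?thesis
          using e(1) by (intro exI[of _ "{t<..<t+e}"]) auto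
      qed
      then obtain T where T: "connected (insert t T)" "T \<subseteq> {t-e..t+e} - {t}" "T \<noteq> {}" "h ` T \<subseteq> ?J"
        by blast
      have "p \<in> topspace (subtopology X M)"
        using p MS by auto
      then obtain C where C: "C \<in> connected_components_of (subtopology X M)" "p \<in> C"
        using Union_connected_components_of by (metis UnionE)
      have sub: "h ` insert t T \<subseteq> C"
      proof (rule image_subset_component[OF C(1) T(1)])
        show "h ` insert t T \<subseteq> M"
          using T(4) p t(2) interior_of_subset[of X M] by auto
      qed (use T(2) e(2) t C(2) in auto)
      obtain u where u: "u \<in> T"
        using T(3) by blast
      have "u \<in> {t-e..t+e}" "u \<noteq> t"
        using u T(2) by blast+
      then have "h u \<noteq> p"
        using e(4) t(2) by blast
      moreover have "h u \<in> C"
        using sub u by blast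
      ultimately have "C \<in> nontrivial_components X M"
        using C by (auto simp: nontrivial_components_def trivial_components_def)
      moreover have "p \<in> X frontier_of C"
      proof -
        have "C \<subseteq> M" "C \<subseteq> S"
          using connected_components_of_subset[OF C(1)] by auto
        then have "p \<in> X closure_of C" "p \<notin> X interior_of C"
          using C(2) p closure_of_subset[of C X] interior_of_mono[of C M X] by auto
        then show ?thesis
          by (simp add: frontier_of_def)
      qed
      ultimately have "p \<in> X derived_set_of ?T"
        by (rule ends)
      then show False
        using isolated derived_set_of_mono[OF trivial_components_disjoint_interior[of M], of X] by blast
    qed
  qed
qed

text \<open>The purely topological equivalence: the hypothesis \<open>regular\<close> is the only trace of the
  dynamics.\<close>

theorem symmetric_cantorval_iff:
  assumes "compact M" "M \<subseteq> S" "M \<noteq> {}"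
    and regular: "X interior_of M \<noteq> {} \<Longrightarrow> X closure_of (X interior_of M) = M"
    and K: "maximal_cantor_part X (M - X interior_of M) K"
  shows "symmetric_cantorval X M \<longleftrightarrow> X interior_of M \<noteq> {} \<and> M = X interior_of M \<union> K"
proof
  let ?J = "X interior_of M" and ?T = "\<Union> (trivial_components X M)"
  have cpt: "compactin X M"
    using assms by (simp add: compactin_subtopology)
  have clo: "closedin X M"
    using assms by (simp add: closed_subset compact_imp_closed)
  have JM: "?J \<subseteq> M"
    by (rule interior_of_subset)
  {
    assume sym: "symmetric_cantorval X M"
    have "M = X closure_of ?J"
      using sym by (simp add: symmetric_cantorval_def)
    then have "?J \<noteq> {}"
      using assms(3) closure_of_empty by metis
    moreover have "M - ?J \<subseteq> K"
    proof (cases "M - ?J = {}")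
      case False
      have "closedin X (M - ?J)"
        using clo by (simp add: closedin_diff)
      then have "compactin X (M - ?J)"
        using cpt by (meson Diff_subset closed_compactin)
      then have "cantor_set X (M - ?J)"
        using False cantorval_boundary_perfect[OF sym] no_arc_in_boundary[of _ M]
        by (auto simp: cantor_set_def)
      then show ?thesis
        using K unfolding maximal_cantor_part_def by blast
    qed auto
    moreover have "K \<subseteq> M"
      using K unfolding maximal_cantor_part_def by blast
    ultimately show "?J \<noteq> {} \<and> M = ?J \<union> K"
      using JM by blast
  }
  {
    assume R: "?J \<noteq> {} \<and> M = ?J \<union> K"
    have "K \<subseteq> M - ?J"
      using K unfolding maximal_cantor_part_def by blast
    then have KE: "K = M - ?J"
      using R by blast
    have "p \<in> X derived_set_of ?T" if C: "C \<in> nontrivial_components X M" "p \<in> X frontier_of C" for C p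
    proof -
      have CC: "C \<in> connected_components_of (subtopology X M)"
        using C(1) by (simp add: nontrivial_components_def)
      have "closedin X C"
        using closedin_connected_components_of[OF CC] clo closedin_trans_full by blast
      then have pC: "p \<in> C"
        using C(2) frontier_of_subset_closedin by blast
      have CM: "C \<subseteq> M"
        using connected_components_of_subset[OF CC] by auto
      \<comment> \<open>An arc of \<open>M\<close> around an interior point lies in the component of that point, which therefore is
          a neighbourhood of it.\<close>
      have "p \<notin> ?J"
      proof
        assume pJ: "p \<in> ?J"
        obtain t where t: "t \<in> D" "p = h t"
          using pC CM assms(2) onto by blast
        obtain e where e: "e > 0" "{t-e..t+e} \<subseteq> D" "h ` {t-e..t+e} \<subseteq> ?J"
          using small_interval[OF t(1) openin_interior_of pJ[unfolded t(2)]] by metis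
        let ?W = "{t-e<..<t+e}"
        have sub: "?W \<subseteq> {t-e..t+e}"
          by auto
        have W: "?W \<subseteq> D" "h ` ?W \<subseteq> M" "t \<in> ?W"
          using subset_trans[OF sub e(2)]
            subset_trans[OF subset_trans[OF image_mono[OF sub] e(3)] JM] e(1) by simp_all
        have "h ` ?W \<subseteq> C"
          using image_subset_component[OF CC _ W] pC t(2) by simp
        then have "h ` ?W \<subseteq> X interior_of C"
          using open_image[of ?W] W(1) by (simp add: interior_of_maximal)
        then have "p \<in> X interior_of C"
          using t(2) W(3) by blast
        then show False
          using C(2) by (simp add: frontier_of_def)
      qed
      then have pK: "p \<in> K"
        using KE pC CM by blast
      then have cantor: "cantor_set X K"
        using K unfolding maximal_cantor_part_def by blast
      have "\<exists>y\<noteq>p. y \<in> ?T \<and> y \<in> U" if U: "p \<in> U" "openin X U" for U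
      proof -
        \<comment> \<open>The points to avoid are \<open>p\<close> itself and the boundary points in nontrivial components.\<close>
        have "countable (insert p (K - ?T))"
          using countable_nontrivial_boundary[OF assms(2)] KE by simp
        moreover have "Hausdorff_space X"
          by (simp add: Hausdorff_space_subtopology)
        ultimately obtain y where "y \<in> U \<inter> K" "y \<notin> insert p (K - ?T)"
          using perfect_compact_not_locally_countable[of X K U "insert p (K - ?T)"] cantor U pK
          unfolding cantor_set_def by blast
        then show ?thesis
          by blast
      qed
      then show ?thesis
        using pC CM assms(2) unfolding in_derived_set_of by auto
    qed
    then show "symmetric_cantorval X M"
      using R regular cpt assms(3) by (simp add: symmetric_cantorval_def)
  }
qed

end

section \<open>The interval and the circle\<close>

lemma arc_parametrization_id:
  assumes "open I"
  shows "arc_parametrization I I (\<lambda>t::real. t)"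
proof
  show "eventually (\<lambda>s. s \<noteq> t) (at t)" for t :: real
    by (simp add: eventually_at_filter)
qed (use assms in \<open>auto simp: openin_open_eq\<close>)

text \<open>To see that \<open>cis\<close> is open onto the circle, rotate a point \<open>cis t\<close> to \<open>1\<close>: there \<open>Arg\<close> is a
  continuous local inverse.\<close>

lemma arc_parametrization_cis: "arc_parametrization (sphere 0 1) UNIV cis"
proof
  show "continuous_on UNIV cis"
    by (intro continuous_intros)
  show "range cis = sphere 0 1"
  proof
    show "sphere 0 1 \<subseteq> range cis"
    proof
      fix z :: complex assume "z \<in> sphere 0 1"
      then have "cis (Arg z) = z"
        by (subst cis_Arg) (auto simp: sgn_div_norm)
      then show "z \<in> range cis"
        by (metis rangeI)
    qed
  qed auto
  show "openin (top_of_set (sphere 0 1)) (cis ` W)" if "open W" for W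
  proof (subst openin_subopen, clarify)
    fix t assume "t \<in> W"
    then have "open ((\<lambda>s. s - t) ` W)" "0 \<in> (\<lambda>s. s - t) ` W"
      using \<open>open W\<close> open_translation_subtract by auto
    moreover have "isCont Arg 1"
      by (rule continuous_at_Arg) auto
    ultimately obtain V where V: "open V" "1 \<in> V" "\<And>w. w \<in> V \<Longrightarrow> Arg w \<in> (\<lambda>s. s - t) ` W"
      unfolding continuous_at_open by (metis Arg_1)
    let ?T = "sphere 0 1 \<inter> (\<lambda>z. z * cis (- t)) -` V"
    have "open ((\<lambda>z. z * cis (- t)) -` V)"
      using V(1) by (intro open_vimage continuous_intros)
    then have "openin (top_of_set (sphere 0 1)) ?T"
      by blast
    moreover have "cis t \<in> ?T"
      using V(2) by (simp add: cis_mult)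
    moreover have "?T \<subseteq> cis ` W"
    proof
      fix z assume z: "z \<in> ?T"
      define w where "w = z * cis (- t)"
      have "norm w = 1"
        using z by (simp add: w_def norm_mult)
      then have "cis (Arg w) = w"
        by (subst cis_Arg) (auto simp: sgn_div_norm)
      moreover obtain s where "s \<in> W" "Arg w = s - t"
        using V(3)[of w] z w_def by blast
      ultimately have "cis s = w * cis t"
        by (metis cis_mult diff_add_cancel)
      also have "\<dots> = z"
        by (simp add: w_def mult.assoc cis_mult)
      finally show "z \<in> cis ` W"
        using \<open>s \<in> W\<close> by blast
    qed
    ultimately show "\<exists>T. openin (top_of_set (sphere 0 1)) T \<and> cis t \<in> T \<and> T \<subseteq> cis ` W"
      by blast
  qed
  show "eventually (\<lambda>s. cis s \<noteq> cis t) (at t)" for t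
    unfolding eventually_at
  proof (intro exI[of _ pi] conjI ballI impI)
    fix s assume s: "s \<noteq> t \<and> dist s t < pi"
    show "cis s \<noteq> cis t"
    proof
      assume "cis s = cis t"
      then have "cis (s - t) = 1"
        by (simp flip: cis_divide)
      then have "sin (s - t) = 0"
        by (metis cis.sel(2) one_complex.sel(2))
      then show False
        using s sin_eq_0_pi[of "s - t"] by (auto simp: dist_real_def abs_less_iff)
    qed
  qed simp
qed auto

text \<open>The set \<open>J\<close> of a canonical decomposition is the union of the components of the interior, that
  is, the interior itself.\<close>

lemma minimal_set_symmetric_cantorval_iff:
  fixes S :: "'a::metric_space set"
  assumes "arc_parametrization S D h"
    and "\<And>i. i \<in> {1..n} \<Longrightarrow> open_map (top_of_set S) (top_of_set S) (f i)"
    and "minimal_set (top_of_set S) f n M" "compact M"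
    and "canonical_decomposition (top_of_set S) M J K N"
  shows "symmetric_cantorval (top_of_set S) M \<longleftrightarrow> J \<noteq> {} \<and> M = J \<union> K"
proof -
  let ?X = "top_of_set S"
  have "J = topspace (subtopology ?X (?X interior_of M))"
    using assms(5) unfolding canonical_decomposition_def Union_connected_components_of by blast
  then have J: "J = ?X interior_of M"
    using interior_of_subset_topspace[of ?X M] by auto
  have K: "maximal_cantor_part ?X (M - J) K"
    using assms(5) unfolding canonical_decomposition_def by (elim conjE)
  have M: "M \<subseteq> S" "M \<noteq> {}"
    using assms(3) closedin_subset[of ?X M] by (auto simp: minimal_set_def)
  show ?thesis
    unfolding J
  proof (rule arc_parametrization.symmetric_cantorval_iff[OF assms(1,4) M])
    show "?X closure_of (?X interior_of M) = M" if "?X interior_of M \<noteq> {}"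
      using minimal_set_eq_closure_interior assms(2,3) that by blast
  qed (use K J in simp)
qed

theorem proposition1:
  shows "(\<forall>(I :: real set) (n :: nat) (f :: nat \<Rightarrow> real \<Rightarrow> real) M J K N.
            open I \<and> is_interval I \<and> I \<noteq> {} \<and> n \<ge> 1 \<and>
            (\<forall>i\<in>{1..n}. f i ` I \<subseteq> I \<and> open_map (top_of_set I) (top_of_set I) (f i)) \<and>
            minimal_set (top_of_set I) f n M \<and> compact M \<and>
            canonical_decomposition (top_of_set I) M J K N \<longrightarrow>
            (symmetric_cantorval (top_of_set I) M \<longleftrightarrow> J \<noteq> {} \<and> M = J \<union> K))
       \<and> (\<forall>(S :: complex set) (n :: nat) (f :: nat \<Rightarrow> complex \<Rightarrow> complex) M J K N.
            S = sphere 0 1 \<and> n \<ge> 1 \<and>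
            (\<forall>i\<in>{1..n}. f i ` S \<subseteq> S \<and> open_map (top_of_set S) (top_of_set S) (f i)) \<and>
            minimal_set (top_of_set S) f n M \<and>
            canonical_decomposition (top_of_set S) M J K N \<longrightarrow>
            (symmetric_cantorval (top_of_set S) M \<longleftrightarrow> J \<noteq> {} \<and> M = J \<union> K))"
proof (intro conjI allI impI; elim conjE)
  fix I :: "real set" and n :: nat and f :: "nat \<Rightarrow> real \<Rightarrow> real" and M J K N
  assume "open I" "compact M"
    and "\<forall>i\<in>{1..n}. f i ` I \<subseteq> I \<and> open_map (top_of_set I) (top_of_set I) (f i)"
    and "minimal_set (top_of_set I) f n M" "canonical_decomposition (top_of_set I) M J K N"
  then show "symmetric_cantorval (top_of_set I) M \<longleftrightarrow> J \<noteq> {} \<and> M = J \<union> K"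
    using arc_parametrization_id by (intro minimal_set_symmetric_cantorval_iff) auto
next
  fix S :: "complex set" and n :: nat and f :: "nat \<Rightarrow> complex \<Rightarrow> complex" and M J K N
  assume S: "S = sphere 0 1"
    and "\<forall>i\<in>{1..n}. f i ` S \<subseteq> S \<and> open_map (top_of_set S) (top_of_set S) (f i)"
    and M: "minimal_set (top_of_set S) f n M" "canonical_decomposition (top_of_set S) M J K N"
  moreover have "compact M"
    using M(1) unfolding minimal_set_def S by (meson closedin_compact compact_sphere)
  ultimately show "symmetric_cantorval (top_of_set S) M \<longleftrightarrow> J \<noteq> {} \<and> M = J \<union> K"
    using arc_parametrization_cis by (intro minimal_set_symmetric_cantorval_iff) auto
qed

end
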